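(* Fix integers $a,b$ (not necessarily positive) and a positive integer $n$. Let $X_1,X_2,\dots$ be i.i.d. random variables with $P(X_i=a)=P(X_i=b)=\tfrac12$, let $S_0=0$ and $S_k=X_1+\dots+X_k$. Define, for $k\ge 0$, $q(n,k)=P(S_j<n \text{ for all } j=0,1,\dots,k)$, and for $k\ge1$, $r(n,k)=P(S_k\ge n \text{ and } S_j<n \text{ for all } j=0,1,\dots,k-1)$. Let $p_n=\sum_{k=1}^{\infty} q(n,k)\, r(n,k)$. If $\lim_{k\to\infty} q(n,k)=0$, then \[ p_n=\frac12-\frac12\sum_{k=1}^{\infty} r(n,k)^2 .\]
   Context: Game interpretation: two players, the first player $A$ and the second player $B$, alternately (A first in each round) add $a$ or $b$ chips, each with probability $1/2$ and independently, to their own piles (both starting from $0$ chips; piles may be negative). The first player whose pile reaches at least $n$ chips wins. $S_k$ models a player's pile after his $k$-th move; $q(n,k)$ is the probability a player has not reached $n$ chips by his $k$-th move, $r(n,k)$ the probability he first reaches at least $n$ chips on his $k$-th move, and $p_n$ is the probability that the second player wins. *)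

theory Defs
  imports "HOL-Probability.Probability"
begin

text \<open>
  The law of one step: \<open>a\<close> or \<open>b\<close>, each chosen with probability \<open>1/2\<close>. Counting with
  multiplicity makes the degenerate case \<open>a = b\<close> the point mass at \<open>a\<close>.
\<close>
definition step_law :: "int \<Rightarrow> int \<Rightarrow> int pmf" where
  "step_law a b = pmf_of_multiset {#a, b#}"

text \<open>Steps are numbered from 1; \<open>X 0\<close> is never used.\<close>
definition walk :: "(nat \<Rightarrow> 'w \<Rightarrow> int) \<Rightarrow> nat \<Rightarrow> 'w \<Rightarrow> int" where
  "walk X k \<omega> = (\<Sum>i=1..k. X i \<omega>)"

definition not_reached_prob :: "'w measure \<Rightarrow> (nat \<Rightarrow> 'w \<Rightarrow> int) \<Rightarrow> int \<Rightarrow> nat \<Rightarrow> real" where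
  "not_reached_prob M X n k = measure M {\<omega> \<in> space M. \<forall>j\<le>k. walk X j \<omega> < n}"

definition first_reach_prob :: "'w measure \<Rightarrow> (nat \<Rightarrow> 'w \<Rightarrow> int) \<Rightarrow> int \<Rightarrow> nat \<Rightarrow> real" where
  "first_reach_prob M X n k =
     measure M {\<omega> \<in> space M. walk X k \<omega> \<ge> n \<and> (\<forall>j<k. walk X j \<omega> < n)}"

text \<open>
  Series over \<open>k \<ge> 1\<close> are written with \<open>Suc k\<close> in place of \<open>k\<close>. Their convergence is
  automatic, see \<open>summable_win_prob\<close> and \<open>summable_first_reach_prob_sq\<close> below.
\<close>
definition second_player_win_prob :: "'w measure \<Rightarrow> (nat \<Rightarrow> 'w \<Rightarrow> int) \<Rightarrow> int \<Rightarrow> real" where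
  "second_player_win_prob M X n =
     (\<Sum>k. not_reached_prob M X n (Suc k) * first_reach_prob M X n (Suc k))"

lemma (in prob_space) distr_eq_step_law_iff:
  fixes Y :: "'a \<Rightarrow> int"
  assumes Y: "random_variable (count_space UNIV) Y" and "a \<noteq> b"
  shows "distr M (count_space UNIV) Y = measure_pmf (step_law a b) \<longleftrightarrow>
    prob {\<omega> \<in> space M. Y \<omega> = a} = 1/2 \<and> prob {\<omega> \<in> space M. Y \<omega> = b} = 1/2"
proof -
  let ?D = "distr M (count_space UNIV) Y"
  have D: "measure ?D {x} = prob {\<omega> \<in> space M. Y \<omega> = x}" for x
    using Y by (subst measure_distr) (auto intro!: arg_cong[where f = prob])
  have P: "pmf (step_law a b) a = 1/2" "pmf (step_law a b) b = 1/2"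
    using \<open>a \<noteq> b\<close> by (simp_all add: step_law_def)
  interpret D: prob_space ?D
    using Y by (rule prob_space_distr)
  show ?thesis
  proof
    assume "?D = measure_pmf (step_law a b)"
    then show "prob {\<omega> \<in> space M. Y \<omega> = a} = 1/2 \<and> prob {\<omega> \<in> space M. Y \<omega> = b} = 1/2"
      using P D[of a] D[of b] by (simp add: pmf.rep_eq)
  next
    assume *: "prob {\<omega> \<in> space M. Y \<omega> = a} = 1/2 \<and> prob {\<omega> \<in> space M. Y \<omega> = b} = 1/2"
    have "measure ?D {a, b} = measure ?D {a} + measure ?D {b}"
      using D.finite_measure_Union[of "{a}" "{b}"] \<open>a \<noteq> b\<close> by (simp add: insert_commute)
    then have "measure ?D {a, b} = 1"
      using * D by simp
    then have "AE x in ?D. x \<in> {a, b}"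
      by (intro D.AE_prob_1)
    moreover have "AE x in measure_pmf (step_law a b). x \<in> {a, b}"
      by (simp add: AE_measure_pmf_iff step_law_def)
    moreover have "emeasure ?D {x} = emeasure (measure_pmf (step_law a b)) {x}"
      if "x \<in> {a, b}" for x
      using that * D P
      by (auto simp: D.emeasure_eq_measure measure_pmf.emeasure_eq_measure pmf.rep_eq)
    ultimately show "?D = measure_pmf (step_law a b)"
      by (intro measure_eqI_countable_AE[where \<Omega> = "{a, b}"]) auto
  qed
qed

lemma (in prob_space) summable_first_reach_prob:
  assumes X: "\<And>i. i \<ge> 1 \<Longrightarrow> random_variable (count_space UNIV) (X i)"
  shows "summable (\<lambda>k. first_reach_prob M X n (Suc k))"
proof -
  let ?A = "\<lambda>k. {\<omega> \<in> space M. walk X k \<omega> \<ge> n \<and> (\<forall>j<k. walk X j \<omega> < n)}"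
  have W [measurable]: "random_variable (count_space UNIV) (walk X k)" for k
  proof (induction k)
    case 0
    then show ?case by (simp add: walk_def)
  next
    case (Suc k)
    have [measurable]: "random_variable (count_space UNIV) (X (Suc k))"
      using X by simp
    note [measurable] = Suc
    have "random_variable (count_space UNIV) (\<lambda>\<omega>. walk X k \<omega> + X (Suc k) \<omega>)"
      by measurable
    then show ?case
      by (simp add: walk_def cong: measurable_cong)
  qed
  have "disjoint_family (\<lambda>k. ?A (Suc k))"
    unfolding disjoint_family_on_def
  proof (intro ballI impI)
    fix k l :: nat
    assume "k \<noteq> l"
    then show "?A (Suc k) \<inter> ?A (Suc l) = {}"
      by (cases k l rule: linorder_cases) fastforce+
  qed
  moreover have "range (\<lambda>k. ?A (Suc k)) \<subseteq> events"
  proof safe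
    fix k
    show "?A (Suc k) \<in> events"
      by measurable
  qed
  ultimately show ?thesis
    using finite_measure_UNION sums_summable unfolding first_reach_prob_def by blast
qed

lemma (in prob_space) summable_first_reach_prob_sq:
  assumes "\<And>i. i \<ge> 1 \<Longrightarrow> random_variable (count_space UNIV) (X i)"
  shows "summable (\<lambda>k. (first_reach_prob M X n (Suc k))\<^sup>2)"
proof (rule summable_comparison_test'[OF summable_first_reach_prob[OF assms, where n = n]])
  show "norm ((first_reach_prob M X n (Suc k))\<^sup>2) \<le> first_reach_prob M X n (Suc k)" for k
    by (simp add: power2_eq_square first_reach_prob_def mult_left_le)
qed

lemma (in prob_space) summable_win_prob:
  assumes "\<And>i. i \<ge> 1 \<Longrightarrow> random_variable (count_space UNIV) (X i)"
  shows "summable (\<lambda>k. not_reached_prob M X n (Suc k) * first_reach_prob M X n (Suc k))"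
proof (rule summable_comparison_test'[OF summable_first_reach_prob[OF assms, where n = n]])
  show "norm (not_reached_prob M X n (Suc k) * first_reach_prob M X n (Suc k))
      \<le> first_reach_prob M X n (Suc k)" for k
    by (simp add: first_reach_prob_def not_reached_prob_def mult_left_le_one_le)
qed

end

(*
  Being below n up to time k splits according to whether n is reached at time k + 1, so
  q(k) = q(k+1) + r(k+1).  Hence q(k)^2 - q(k+1)^2 = 2 q(k+1) r(k+1) + r(k+1)^2, and the left
  side telescopes to q(0)^2 = 1 because q tends to 0.
*)
theory Submission
  imports Defs
begin

text \<open>Each partial sum is the previous one plus a single measurable step. This makes the
  events behind \<open>not_reached_prob\<close> and \<open>first_reach_prob\<close> measurable, as
  additivity requires.\<close>

lemma measurable_walk:
  assumes "\<And>i. i \<ge> 1 \<Longrightarrow> X i \<in> measurable M (count_space UNIV)"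
  shows "walk X k \<in> measurable M (count_space UNIV)"
proof (induction k)
  case 0
  then show ?case by (simp add: walk_def)
next
  case (Suc k)
  note [measurable] = Suc assms[of "Suc k", simplified]
  have "(\<lambda>\<omega>. walk X k \<omega> + X (Suc k) \<omega>) \<in> measurable M (count_space UNIV)"
    by measurable
  then show ?case
    by (simp add: walk_def cong: measurable_cong)
qed

text \<open>The empty sum puts the walk at 0, and this is where positivity of \<open>n\<close>
  enters.\<close>

lemma (in prob_space) not_reached_prob_0:
  assumes "n > 0"
  shows "not_reached_prob M X n 0 = 1"
  using assms by (simp add: not_reached_prob_def walk_def prob_space)

lemma (in prob_space) not_reached_prob_Suc:
  assumes "\<And>i. i \<ge> 1 \<Longrightarrow> random_variable (count_space UNIV) (X i)"
  shows "not_reached_prob M X n k =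
    not_reached_prob M X n (Suc k) + first_reach_prob M X n (Suc k)"
proof -
  note [measurable] = measurable_walk[OF assms]
  let ?Q = "{\<omega> \<in> space M. \<forall>j\<le>Suc k. walk X j \<omega> < n}"
  let ?R = "{\<omega> \<in> space M. walk X (Suc k) \<omega> \<ge> n \<and> (\<forall>j<Suc k. walk X j \<omega> < n)}"
  have "?Q \<in> events" "?R \<in> events"
    by measurable
  moreover have "?Q \<inter> ?R = {}"
    by force
  \<comment> \<open>Since \<open>j < Suc k\<close> means \<open>j \<le> k\<close>, both events
    demand staying below \<open>n\<close> up to time \<open>k\<close>; only the position at time
    \<open>Suc k\<close> separates them.\<close>
  moreover have "{\<omega> \<in> space M. \<forall>j\<le>k. walk X j \<omega> < n} = ?Q \<union> ?R"
    by (auto simp: le_Suc_eq less_Suc_eq_le)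
  ultimately show ?thesis
    unfolding not_reached_prob_def first_reach_prob_def
    by (simp only: finite_measure_Union)
qed

theorem theorem1:
  fixes M :: "'w measure" and X :: "nat \<Rightarrow> 'w \<Rightarrow> int" and a b n :: int
  assumes "n > 0"
    and "prob_space M"
    and "prob_space.indep_vars M (\<lambda>_. count_space UNIV) X {1..}"
    and "\<And>i. i \<ge> 1 \<Longrightarrow> distr M (count_space UNIV) (X i) = measure_pmf (step_law a b)"
    and "(\<lambda>k. not_reached_prob M X n k) \<longlonglongrightarrow> 0"
  shows "second_player_win_prob M X n =
    1/2 - 1/2 * (\<Sum>k. (first_reach_prob M X n (Suc k))\<^sup>2)"
proof -
  interpret prob_space M by fact
  have X: "random_variable (count_space UNIV) (X i)" if "i \<ge> 1" for i
    using assms(3) that by (simp add: indep_vars_def)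
  let ?q = "not_reached_prob M X n" and ?r = "first_reach_prob M X n"
  have "(\<lambda>k. (?q k)\<^sup>2) \<longlonglongrightarrow> 0"
    using tendsto_power[OF assms(5), of 2] by simp
  \<comment> \<open>The telescoping value is the initial term minus the limit, here 1 - 0.\<close>
  then have "(\<lambda>k. (?q k)\<^sup>2 - (?q (Suc k))\<^sup>2) sums 1"
    using telescope_sums'[of "\<lambda>k. (?q k)\<^sup>2" 0] by (simp add: not_reached_prob_0 \<open>n > 0\<close>)
  moreover have "(?q k)\<^sup>2 - (?q (Suc k))\<^sup>2 = 2 * (?q (Suc k) * ?r (Suc k)) + (?r (Suc k))\<^sup>2" for k
  proof -
    have "?q k = ?q (Suc k) + ?r (Suc k)"
      using X by (rule not_reached_prob_Suc)
    then show ?thesis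
      by (simp add: power2_sum)
  qed
  ultimately have "(\<lambda>k. 2 * (?q (Suc k) * ?r (Suc k)) + (?r (Suc k))\<^sup>2) sums 1"
    by (simp only:)
  \<comment> \<open>The same series is summed a second way, term by term; this is legitimate because
    both parts converge separately. Uniqueness of the sum then equates the two values.\<close>
  moreover have "(\<lambda>k. 2 * (?q (Suc k) * ?r (Suc k)) + (?r (Suc k))\<^sup>2) sums
      (2 * second_player_win_prob M X n + (\<Sum>k. (?r (Suc k))\<^sup>2))"
    unfolding second_player_win_prob_def
    by (intro sums_add sums_mult summable_sums summable_win_prob
        summable_first_reach_prob_sq X)
  ultimately have "2 * second_player_win_prob M X n + (\<Sum>k. (?r (Suc k))\<^sup>2) = 1"
    by (rule sums_unique2[symmetric])
  then show ?thesis by simp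
qed

end
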